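(* Let $\mathcal{K}\subseteq\mathbb{R}^d$ be a convex cone, let $f:\mathcal{K}\to\mathbb{R}$ be differentiable, strictly convex, with $L$-Lipschitz continuous gradient, and let $\mathbf{x}^*\neq\mathbf{0}$ be an optimal solution of $\min_{\mathbf{x}\in\mathcal{K}}f(\mathbf{x})$. Let $(\mathbf{x}_k),(\eta_k)$ be generated by MOCO with $\delta_k=\frac{2}{k+2}$ from $\mathbf{x}_0\in\mathcal{K}$. Then for every $k\ge 0$, $$\big[\mathrm{dist}_*\big(\nabla f(\eta_k\mathbf{x}_k),\mathcal{K}^*\big)\big]^2\ \le\ \frac{4L^2\|\mathbf{x}^*\|^2}{k+1}.$$
   Context: Here $\|\cdot\|$ is a norm on $\mathbb{R}^d$ with dual norm $\|\cdot\|_*$; $\mathcal{K}^*$ is the dual cone of $\mathcal{K}$; $\mathrm{dist}_*(\mathbf{u},\mathcal{S})$ is the distance from $\mathbf{u}$ to the set $\mathcal{S}$ measured in $\|\cdot\|_*$. A convex cone $\mathcal{K}$ satisfies $\lambda_1\mathbf{x}+\lambda_2\mathbf{y}\in\mathcal{K}$ for all $\lambda_1,\lambda_2\ge 0$ and $\mathbf{x},\mathbf{y}\in\mathcal{K}$. $L$-Lipschitz gradient means $\|\nabla f(\mathbf{x})-\nabla f(\mathbf{y})\|_*\le L\|\mathbf{x}-\mathbf{y}\|$ for all $\mathbf{x},\mathbf{y}\in\mathcal{K}$. Strict convexity means $f(\mathbf{y})-f(\mathbf{x})>\langle\nabla f(\mathbf{x}),\mathbf{y}-\mathbf{x}\rangle$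 for all $\mathbf{x}\ne\mathbf{y}$ in $\mathcal{K}$. MOCO (momentum conic descent): given $\mathbf{x}_0\in\mathcal{K}$ and $\delta_k=\frac{2}{k+2}$, for $k=0,1,\dots$ (each argmin denotes a chosen minimizer, assumed to be attained): (1) $\eta_k\in\arg\min_{\eta\ge 0}f(\eta\mathbf{x}_k)$; (2) $\mathbf{g}_k=(1-\delta_k)\mathbf{g}_{k-1}+\delta_k\nabla f(\eta_k\mathbf{x}_k)$ (since $\delta_0=1$, $\mathbf{g}_{-1}$ is irrelevant); (3) $\mathbf{v}_k\in\arg\min\{\langle\mathbf{g}_k,\mathbf{v}\rangle:\ \mathbf{v}\in\mathcal{K},\ \|\mathbf{v}\|\le 1\}$; (4) $\theta_k\in\arg\min_{\theta\ge 0}f(\eta_k\mathbf{x}_k+\theta\mathbf{v}_k)$; (5) $\mathbf{x}_{k+1}=\eta_k\mathbf{x}_k+\theta_k\mathbf{v}_k$. *)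

theory Defs
  imports "HOL-Analysis.Analysis"
begin

text \<open>The class constant \<^const>\<open>norm\<close> is fixed to the Euclidean norm on \<^typ>\<open>real ^ 'n\<close>, so an arbitrary
  norm is passed as an explicit function.\<close>

definition is_norm :: "('a::real_vector \<Rightarrow> real) \<Rightarrow> bool" where
  "is_norm N \<longleftrightarrow>
     (\<forall>x. 0 \<le> N x) \<and> (\<forall>x. N x = 0 \<longleftrightarrow> x = 0) \<and>
     (\<forall>c x. N (c *\<^sub>R x) = \<bar>c\<bar> * N x) \<and>
     (\<forall>x y. N (x + y) \<le> N x + N y)"

text \<open>In a Euclidean space the unit ball of a norm is bounded, so the supremum below is finite.\<close>

definition dual_norm :: "('a::euclidean_space \<Rightarrow> real) \<Rightarrow> 'a \<Rightarrow> real" where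
  "dual_norm N u = (SUP v\<in>{v. N v \<le> 1}. u \<bullet> v)"

definition dual_cone :: "'a::real_inner set \<Rightarrow> 'a set" where
  "dual_cone K = {u. \<forall>x\<in>K. 0 \<le> u \<bullet> x}"

definition dist_wrt :: "('a::ab_group_add \<Rightarrow> real) \<Rightarrow> 'a \<Rightarrow> 'a set \<Rightarrow> real" where
  "dist_wrt N u S = (INF s\<in>S. N (u - s))"

text \<open>The derivative is taken within \<open>K\<close>, as \<open>f\<close> is only given on \<open>K\<close>. If \<open>K\<close> does not span the space,
  a gradient is not unique, and \<open>grad\<close> may then be any field of gradients.\<close>

definition gradient_on :: "('a::real_inner \<Rightarrow> real) \<Rightarrow> ('a \<Rightarrow> 'a) \<Rightarrow> 'a set \<Rightarrow> bool" where
  "gradient_on f grad K \<longleftrightarrow> (\<forall>x\<in>K. (f has_derivative (\<lambda>h. grad x \<bullet> h)) (at x within K))"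

definition strictly_convex_grad_on :: "('a::real_inner \<Rightarrow> real) \<Rightarrow> ('a \<Rightarrow> 'a) \<Rightarrow> 'a set \<Rightarrow> bool" where
  "strictly_convex_grad_on f grad K \<longleftrightarrow>
     (\<forall>x\<in>K. \<forall>y\<in>K. x \<noteq> y \<longrightarrow> f y - f x > grad x \<bullet> (y - x))"

definition lipschitz_gradient_on ::
    "('a::euclidean_space \<Rightarrow> real) \<Rightarrow> real \<Rightarrow> ('a \<Rightarrow> 'a) \<Rightarrow> 'a set \<Rightarrow> bool" where
  "lipschitz_gradient_on N L grad K \<longleftrightarrow>
     (\<forall>x\<in>K. \<forall>y\<in>K. dual_norm N (grad x - grad y) \<le> L * N (x - y))"

definition moco_step :: "nat \<Rightarrow> real" where
  "moco_step k = 2 / (real k + 2)"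

text \<open>\<open>moco N K f grad g_init x \<eta> g v \<theta>\<close>: the five sequences form a run of momentum conic descent.
  The vector \<open>g_init\<close> plays the role of \<open>g\<close> at index \<open>-1\<close>; its coefficient is
  \<open>1 - moco_step 0 = 0\<close>.\<close>

definition moco ::
    "('a::euclidean_space \<Rightarrow> real) \<Rightarrow> 'a set \<Rightarrow> ('a \<Rightarrow> real) \<Rightarrow> ('a \<Rightarrow> 'a) \<Rightarrow> 'a \<Rightarrow>
     (nat \<Rightarrow> 'a) \<Rightarrow> (nat \<Rightarrow> real) \<Rightarrow> (nat \<Rightarrow> 'a) \<Rightarrow> (nat \<Rightarrow> 'a) \<Rightarrow> (nat \<Rightarrow> real) \<Rightarrow> bool" where
  "moco N K f grad g_init x \<eta> g v \<theta> \<longleftrightarrow>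
     x 0 \<in> K \<and>
     (\<forall>k.
        is_arg_min (\<lambda>s. f (s *\<^sub>R x k)) (\<lambda>s. 0 \<le> s) (\<eta> k) \<and>
        g k = (1 - moco_step k) *\<^sub>R (case k of 0 \<Rightarrow> g_init | Suc j \<Rightarrow> g j)
                + moco_step k *\<^sub>R grad (\<eta> k *\<^sub>R x k) \<and>
        is_arg_min (\<lambda>w. g k \<bullet> w) (\<lambda>w. w \<in> K \<and> N w \<le> 1) (v k) \<and>
        is_arg_min (\<lambda>t. f (\<eta> k *\<^sub>R x k + t *\<^sub>R v k)) (\<lambda>t. 0 \<le> t) (\<theta> k) \<and>
        x (Suc k) = \<eta> k *\<^sub>R x k + \<theta> k *\<^sub>R v k)"

end

theory Submission
  imports Defs
begin

text \<open>
  Write \<open>y k = \<eta> k *\<^sub>R x k\<close> and \<open>R = N xs\<close>. Two facts give the bound: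
  the squared distance from \<open>grad (y k)\<close> to the dual cone is at most
  \<open>2 * L * (f (y k) - f xs)\<close>, and \<open>f (y k) - f xs\<close> is at most \<open>2 * L * R\<^sup>2 / (k + 1)\<close>.

  The first (\<open>dist_dual_cone_sq_le_gap\<close>) concerns any point of the cone. By convex duality
  (\<open>dist_dual_cone_le\<close>) the distance is the steepest slope of descent among the directions of
  unit length in the cone. A steep slope, together with the quadratic upper bound on \<open>f\<close> from the
  Lipschitz gradient, would lead to a point of the cone with a value below the minimum.

  The second (\<open>moco_gap_le\<close>) is the rate of the Frank-Wolfe method with momentum on the part of
  the cone in the ball of radius \<open>R\<close>, although the algorithm does not know \<open>R\<close>. Scaling \<open>x k\<close>
  optimally makes \<open>grad (y k)\<close> orthogonal to \<open>y k\<close> (\<open>grad_inner_self_eq_0\<close>). The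
  tangent of \<open>f\<close> at \<open>y k\<close> is then \<open>f (y k) + grad (y k) \<bullet> z\<close>. Averages of tangents are again of
  this form, with linear part \<open>g k\<close>; they are minorants of \<open>f\<close> (\<open>avg_tangent_le\<close>), and on the
  ball of radius \<open>R\<close> they are minimised at \<open>R *\<^sub>R v k\<close>. Since the line search over \<open>\<theta>\<close> is at
  least as good as the Frank-Wolfe step \<open>moco_step k * R\<close>, the values \<open>f (y (Suc k))\<close> stay within
  \<open>2 * L * R\<^sup>2 / (k + 2)\<close> of these minima (\<open>moco_estimate_sequence\<close>), which are at
  most \<open>f xs\<close>.
\<close>

section \<open>A norm and its dual\<close>

context
  fixes N :: "'a::euclidean_space \<Rightarrow> real"
  assumes N: "is_norm N"
begin

lemma norm_nonneg: "0 \<le> N x"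
  and norm_eq_0: "N x = 0 \<longleftrightarrow> x = 0"
  and norm_scaleR: "N (c *\<^sub>R x) = \<bar>c\<bar> * N x"
  and norm_triangle: "N (x + y) \<le> N x + N y"
  using N by (auto simp: is_norm_def)

lemma norm_zero: "N 0 = 0"
  by (simp add: norm_eq_0)

lemma norm_uminus: "N (- x) = N x"
  using norm_scaleR[of "-1" x] by simp

lemma convex_on_norm: "convex_on UNIV N"
proof (rule convex_onI)
  fix t x y assume "0 < t" "t < (1::real)"
  then show "N ((1 - t) *\<^sub>R x + t *\<^sub>R y) \<le> (1 - t) * N x + t * N y"
    using norm_triangle[of "(1 - t) *\<^sub>R x" "t *\<^sub>R y"] by (simp add: norm_scaleR)
qed simp

text \<open>A norm has a positive minimum on the Euclidean sphere. This is what makes the supremum in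
  the dual norm finite.\<close>

lemma euclidean_norm_le_norm:
  obtains C where "0 \<le> C" "\<And>v. norm v \<le> C * N v"
proof -
  have "continuous_on (sphere 0 1) N"
    using convex_on_continuous[OF open_UNIV convex_on_norm] continuous_on_subset by blast
  moreover have "sphere (0::'a) 1 \<noteq> {}"
    by simp
  ultimately obtain w where w: "w \<in> sphere 0 1" "\<And>u. u \<in> sphere 0 1 \<Longrightarrow> N w \<le> N u"
    using continuous_attains_inf[of "sphere 0 1" N] by auto
  have "w \<noteq> 0"
    using w(1) by auto
  then have pos: "0 < N w"
    using norm_nonneg[of w] norm_eq_0[of w] by simp
  have "norm v \<le> inverse (N w) * N v" for v
  proof (cases "v = 0")
    case False
    then have "N w \<le> N (inverse (norm v) *\<^sub>R v)"
      by (intro w(2)) simp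
    then have "N w \<le> N v / norm v"
      by (simp add: norm_scaleR divide_inverse mult.commute)
    then show ?thesis
      using False pos by (simp add: field_simps)
  qed (simp add: norm_zero)
  then show ?thesis
    using that[of "inverse (N w)"] pos by simp
qed

lemma bdd_above_dual_norm: "bdd_above ((\<lambda>v. u \<bullet> v) ` {v. N v \<le> 1})"
proof -
  obtain C where C: "0 \<le> C" "\<And>v. norm v \<le> C * N v"
    using euclidean_norm_le_norm by blast
  have "u \<bullet> v \<le> norm u * C" if "N v \<le> 1" for v
  proof -
    have "norm v \<le> C"
      using C(2)[of v] mult_left_mono[OF that C(1)] by simp
    then show ?thesis
      using norm_cauchy_schwarz[of u v] mult_left_mono[of "norm v" C "norm u"] by simp
  qed
  then show ?thesis
    by (intro bdd_aboveI2[where M = "norm u * C"]) simp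
qed

lemma dual_norm_nonneg: "0 \<le> dual_norm N u"
  unfolding dual_norm_def
  using cSUP_upper[OF _ bdd_above_dual_norm, of 0 u] by (simp add: norm_zero)

lemma inner_le_dual_norm: "u \<bullet> v \<le> dual_norm N u * N v"
proof (cases "v = 0")
  case False
  then have pos: "0 < N v"
    using norm_nonneg[of v] norm_eq_0[of v] by simp
  then have "u \<bullet> (inverse (N v) *\<^sub>R v) \<le> dual_norm N u"
    unfolding dual_norm_def by (intro cSUP_upper bdd_above_dual_norm) (simp add: norm_scaleR)
  then show ?thesis
    using pos by (simp add: field_simps)
qed (simp add: norm_zero)

lemma dual_norm_le:
  assumes "0 \<le> \<tau>" "\<And>v. u \<bullet> v \<le> \<tau> * N v"
  shows "dual_norm N u \<le> \<tau>"
  unfolding dual_norm_def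
proof (rule cSUP_least)
  show "{v. N v \<le> 1} \<noteq> {}"
    using norm_zero by (auto intro: exI[of _ 0])
  show "u \<bullet> v \<le> \<tau>" if "v \<in> {v. N v \<le> 1}" for v
    using that assms(2)[of v] mult_left_mono[of "N v" 1 \<tau>] assms(1) by simp
qed

section \<open>Distance to the dual cone\<close>

lemma dist_dual_cone_nonneg: "0 \<le> dist_wrt (dual_norm N) u (dual_cone K)"
proof -
  have "0 \<in> dual_cone K"
    by (simp add: dual_cone_def)
  then show ?thesis
    unfolding dist_wrt_def by (intro cINF_greatest dual_norm_nonneg) auto
qed

text \<open>This is the nontrivial half of the duality between the distance to the dual cone and the
  steepest conic descent slope. The hypothesis says that the epigraph of \<open>\<tau> * N\<close> lies above the
  graph of \<open>- u\<close> over \<open>K\<close>. A hyperplane between the two convex sets is the graph of a linear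
  functional \<open>- a\<close>; lying below the epigraph gives \<open>dual_norm N a \<le> \<tau>\<close>, and lying above
  \<open>- u\<close> on \<open>K\<close> puts \<open>u - a\<close> in the dual cone.\<close>

lemma dist_dual_cone_le:
  assumes K: "convex_cone K" and \<tau>: "0 \<le> \<tau>"
    and slope: "\<And>v. v \<in> K \<Longrightarrow> - (u \<bullet> v) \<le> \<tau> * N v"
  shows "dist_wrt (dual_norm N) u (dual_cone K) \<le> \<tau>"
proof -
  define S where "S = {(v, t). v \<in> K \<and> t \<le> - (u \<bullet> v)}"
  define T where "T = {(v, t). \<tau> * N v < t}"
  have K0: "0 \<in> K"
    using K by (rule convex_cone_contains_0)
  have "convex S"
    unfolding convex_def
  proof safe
    fix v1 t1 v2 t2 and a b :: real
    assume *: "(v1, t1) \<in> S" "(v2, t2) \<in> S" "0 \<le> a" "0 \<le> b" "a + b = 1"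
    then have "a *\<^sub>R v1 + b *\<^sub>R v2 \<in> K"
      using K by (simp add: S_def convex_cone_iff)
    moreover have "a * t1 + b * t2 \<le> a * - (u \<bullet> v1) + b * - (u \<bullet> v2)"
      using * by (intro add_mono mult_left_mono) (auto simp: S_def)
    ultimately show "a *\<^sub>R (v1, t1) + b *\<^sub>R (v2, t2) \<in> S"
      by (simp add: S_def inner_simps)
  qed
  moreover have "convex T"
    unfolding convex_def
  proof safe
    fix v1 t1 v2 t2 and a b :: real
    assume *: "(v1, t1) \<in> T" "(v2, t2) \<in> T" "0 \<le> a" "0 \<le> b" "a + b = 1"
    have "\<tau> * N (a *\<^sub>R v1 + b *\<^sub>R v2) \<le> \<tau> * (a * N v1 + b * N v2)"
      using norm_triangle[of "a *\<^sub>R v1" "b *\<^sub>R v2"] * \<tau>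
      by (intro mult_left_mono) (simp_all add: norm_scaleR)
    also have "\<dots> = a * (\<tau> * N v1) + b * (\<tau> * N v2)"
      by (simp add: algebra_simps)
    also have "\<dots> < a * t1 + b * t2"
    proof (cases "a = 0")
      case True
      then show ?thesis
        using * by (simp add: T_def)
    next
      case False
      then show ?thesis
        using * by (intro add_less_le_mono mult_strict_left_mono mult_left_mono) (auto simp: T_def)
    qed
    finally show "a *\<^sub>R (v1, t1) + b *\<^sub>R (v2, t2) \<in> T"
      by (simp add: T_def)
  qed
  moreover have "S \<inter> T = {}"
    using slope by (force simp: S_def T_def)
  moreover have "(0, 0) \<in> S"
    using K0 by (simp add: S_def)
  moreover have T1: "(0, 1) \<in> T"
    by (simp add: T_def norm_zero)
  ultimately obtain p c where p: "p \<noteq> 0"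
      and le: "\<And>z. z \<in> S \<Longrightarrow> p \<bullet> z \<le> c" and ge: "\<And>z. z \<in> T \<Longrightarrow> c \<le> p \<bullet> z"
    using separating_hyperplane_sets[of S T] by blast
  obtain q b where qb: "p = (q, b)"
    by (cases p)
  have leS: "q \<bullet> v + b * t \<le> c" if "v \<in> K" "t \<le> - (u \<bullet> v)" for v t
    using le[of "(v, t)"] that by (simp add: S_def qb)
  have geT: "c \<le> q \<bullet> v + b * t" if "\<tau> * N v < t" for v t
    using ge[of "(v, t)"] that by (simp add: T_def qb)
  have c0: "0 \<le> c"
    using leS[of 0 0] K0 by simp
  have "0 \<le> b"
    using c0 geT[of 0 1] by (simp add: norm_zero)
  moreover have "b \<noteq> 0"
  proof
    assume b: "b = 0"
    have "0 \<le> q \<bullet> (- q)"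
      using c0 geT[of "- q" "\<tau> * N (- q) + 1"] b by simp
    then have "q = 0"
      by (metis inner_eq_zero_iff inner_ge_zero inner_minus_right neg_0_le_iff_le order_antisym)
    then show False
      using p b qb by (simp add: zero_prod_def)
  qed
  ultimately have b: "0 < b"
    by simp
  define a where "a = inverse b *\<^sub>R q"
  have q: "q = b *\<^sub>R a"
    using b by (simp add: a_def)
  have lower: "0 \<le> a \<bullet> v + \<tau> * N v" for v
  proof (rule field_le_epsilon)
    fix e :: real assume "0 < e"
    then have "0 \<le> b * (a \<bullet> v + (\<tau> * N v + e))"
      using c0 geT[of v "\<tau> * N v + e"] by (simp add: q algebra_simps)
    then show "0 \<le> a \<bullet> v + \<tau> * N v + e"
      using b by (simp add: zero_le_mult_iff add.assoc)
  qed
  have "c \<le> 0"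
  proof (rule field_le_epsilon)
    fix e :: real assume "0 < e"
    then show "c \<le> 0 + e"
      using geT[of 0 "e / b"] b by (simp add: norm_zero)
  qed
  have "a \<bullet> v \<le> u \<bullet> v" if "v \<in> K" for v
  proof -
    have "b * (a \<bullet> v - u \<bullet> v) \<le> 0"
      using leS[OF that order_refl] \<open>c \<le> 0\<close> by (simp add: q algebra_simps)
    then show ?thesis
      using b by (simp add: mult_le_0_iff)
  qed
  then have mem: "u - a \<in> dual_cone K"
    by (simp add: dual_cone_def inner_diff_left)
  have "dist_wrt (dual_norm N) u (dual_cone K) \<le> dual_norm N (u - (u - a))"
    unfolding dist_wrt_def
    by (rule cINF_lower[OF bdd_belowI2[where m = 0] mem]) (rule dual_norm_nonneg)
  also have "\<dots> \<le> \<tau>"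
  proof (rule dual_norm_le[OF \<tau>])
    show "(u - (u - a)) \<bullet> v \<le> \<tau> * N v" for v
      using lower[of "- v"] by (simp add: norm_uminus)
  qed
  finally show ?thesis .
qed

section \<open>Smooth functions on a convex cone\<close>

context
  fixes K :: "'a set" and f :: "'a \<Rightarrow> real" and grad :: "'a \<Rightarrow> 'a" and L :: real
  assumes K: "convex_cone K"
    and grad: "gradient_on f grad K"
    and lip: "lipschitz_gradient_on N L grad K"
begin

lemma dual_norm_grad_diff_le:
  "a \<in> K \<Longrightarrow> b \<in> K \<Longrightarrow> dual_norm N (grad a - grad b) \<le> L * N (a - b)"
  using lip by (simp add: lipschitz_gradient_on_def)

text \<open>The derivative of \<open>f\<close> exists only within \<open>K\<close>, which may have empty interior. Restricting to the
  segment gives a function of one real variable, and subtracting the quadratic upper model from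
  it leaves a nonpositive derivative.\<close>

lemma descent_lemma:
  assumes y: "y \<in> K" and z: "y + h \<in> K"
  shows "f (y + h) \<le> f y + grad y \<bullet> h + L / 2 * (N h)\<^sup>2"
proof -
  have seg: "y + t *\<^sub>R h \<in> K" if "0 \<le> t" "t \<le> 1" for t
  proof -
    have "(1 - t) *\<^sub>R y + t *\<^sub>R (y + h) \<in> K"
      using K y z that by (simp add: convex_cone_iff)
    then show ?thesis
      by (simp add: algebra_simps)
  qed
  define \<phi> where "\<phi> t = f (y + t *\<^sub>R h) - t * (grad y \<bullet> h) - L / 2 * (N h)\<^sup>2 * t\<^sup>2" for t
  have der: "(\<phi> has_derivative
      (\<lambda>s. grad (y + t *\<^sub>R h) \<bullet> (s *\<^sub>R h) - s * (grad y \<bullet> h) - L * (N h)\<^sup>2 * t * s))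
      (at t within {0..1})" if t: "0 \<le> t" "t \<le> 1" for t
  proof -
    have f': "(f has_derivative (\<lambda>h'. grad (y + t *\<^sub>R h) \<bullet> h')) (at (y + t *\<^sub>R h) within K)"
      using grad seg[OF t] by (simp add: gradient_on_def)
    have img: "(\<lambda>t. y + t *\<^sub>R h) ` {0..1} \<subseteq> K"
      using seg by auto
    have line: "((\<lambda>t. y + t *\<^sub>R h) has_derivative (\<lambda>s. s *\<^sub>R h)) (at t within {0..1})"
      by (auto intro!: derivative_eq_intros)
    have "((\<lambda>t. f (y + t *\<^sub>R h)) has_derivative (\<lambda>s. grad (y + t *\<^sub>R h) \<bullet> (s *\<^sub>R h)))
        (at t within {0..1})"
      using has_derivative_in_compose2[of K f "\<lambda>x h'. grad x \<bullet> h'", OF _ img _ line]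
        grad t by (simp add: gradient_on_def)
    then show ?thesis
      unfolding \<phi>_def by (auto intro!: derivative_eq_intros simp: field_simps)
  qed
  obtain t where t: "t \<in> {0..1}" and
    eq: "\<phi> 1 - \<phi> 0 = grad (y + t *\<^sub>R h) \<bullet> h - grad y \<bullet> h - L * (N h)\<^sup>2 * t"
    using mvt_very_simple[of 0 1 \<phi>, OF _ der] by auto
  have "(grad (y + t *\<^sub>R h) - grad y) \<bullet> h \<le> dual_norm N (grad (y + t *\<^sub>R h) - grad y) * N h"
    by (rule inner_le_dual_norm)
  also have "\<dots> \<le> (L * N (y + t *\<^sub>R h - y)) * N h"
    using seg[of t] y t by (intro mult_right_mono norm_nonneg dual_norm_grad_diff_le) auto
  also have "\<dots> = L * (N h)\<^sup>2 * t"
    using t by (simp add: norm_scaleR power2_eq_square)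
  finally have "\<phi> 1 \<le> \<phi> 0"
    using eq by (simp add: inner_diff_left)
  then show ?thesis
    by (simp add: \<phi>_def)
qed

text \<open>Near a minimiser along its own ray, both the directions \<open>y\<close> and \<open>- y\<close> are feasible, so the
  slope \<open>grad y \<bullet> y\<close> is dominated by a quadratic term from either side.\<close>

lemma grad_inner_self_eq_0:
  assumes y: "y \<in> K" and min: "\<And>s. 0 \<le> s \<Longrightarrow> f y \<le> f (s *\<^sub>R y)"
  shows "grad y \<bullet> y = 0"
proof -
  define a where "a = grad y \<bullet> y"
  define M where "M = L / 2 * (N y)\<^sup>2"
  have quad: "0 \<le> t * a + M * t\<^sup>2" if "- 1 \<le> t" for t
  proof -
    have "(1 + t) *\<^sub>R y \<in> K"
      using K y that by (simp add: convex_cone_scaleR)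
    then have "f ((1 + t) *\<^sub>R y) \<le> f y + t * a + M * t\<^sup>2"
      using descent_lemma[OF y, of "t *\<^sub>R y"]
      by (simp add: a_def M_def norm_scaleR power_mult_distrib algebra_simps)
    then show ?thesis
      using min[of "1 + t"] that by simp
  qed
  define s where "s = 1 / (1 + \<bar>a\<bar> + \<bar>M\<bar>)"
  have s: "0 < s" "s * \<bar>a\<bar> \<le> 1" "M * s < 1"
    by (auto simp: s_def field_simps)
  have "\<bar>s * a\<bar> \<le> 1"
    using s by (simp add: abs_mult)
  \<comment> \<open>The step \<open>- s * a\<close> is feasible, and short enough that the linear term \<open>- s * a\<^sup>2\<close> wins.\<close>
  then have "0 \<le> - (s * a\<^sup>2) * (1 - M * s)"
    using quad[of "- (s * a)"] by (simp add: power2_eq_square algebra_simps)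
  then have "a\<^sup>2 \<le> 0"
    using s by (simp add: zero_le_mult_iff mult_le_0_iff)
  then show ?thesis
    by (simp add: a_def)
qed

text \<open>Along a direction of unit length and slope \<open>- s\<close>, the quadratic upper model of the descent
  lemma decreases by up to \<open>s\<^sup>2 / (2 * L)\<close>, which cannot exceed the optimality gap. This bounds
  all conic slopes, hence by duality the distance.\<close>

lemma dist_dual_cone_sq_le_gap:
  assumes L: "0 < L" and y: "y \<in> K" and m: "\<And>z. z \<in> K \<Longrightarrow> m \<le> f z"
  shows "(dist_wrt (dual_norm N) (grad y) (dual_cone K))\<^sup>2 \<le> 2 * L * (f y - m)"
proof -
  define \<tau> where "\<tau> = sqrt (2 * L * (f y - m))"
  have \<tau>: "0 \<le> \<tau>" "\<tau>\<^sup>2 = 2 * L * (f y - m)"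
    using L m[OF y] by (simp_all add: \<tau>_def)
  have "dist_wrt (dual_norm N) (grad y) (dual_cone K) \<le> \<tau>"
  proof (rule dist_dual_cone_le[OF K \<tau>(1)])
    fix v assume v: "v \<in> K"
    show "- (grad y \<bullet> v) \<le> \<tau> * N v"
    proof (cases "v = 0 \<or> 0 \<le> grad y \<bullet> v")
      case True
      then show ?thesis
        using \<tau>(1) norm_nonneg[of v] by (auto simp: norm_zero intro: order_trans[of _ 0])
    next
      case False
      define s where "s = - (grad y \<bullet> v)"
      define n where "n = N v"
      have s: "0 < s" and n: "0 < n"
        using False norm_nonneg[of v] norm_eq_0[of v] by (auto simp: s_def n_def)
      \<comment> \<open>The minimiser of the upper model \<open>t \<mapsto> f y - t * s + L / 2 * t\<^sup>2 * n\<^sup>2\<close>.\<close>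
      define t where "t = s / (L * n\<^sup>2)"
      have t: "0 \<le> t"
        using s L by (simp add: t_def)
      then have z: "y + t *\<^sub>R v \<in> K"
        using K y v by (simp add: convex_cone_add convex_cone_scaleR)
      have "m \<le> f y + grad y \<bullet> (t *\<^sub>R v) + L / 2 * (N (t *\<^sub>R v))\<^sup>2"
        using m[OF z] descent_lemma[OF y z] by simp
      also have "\<dots> = f y - t * s + L / 2 * (t\<^sup>2 * n\<^sup>2)"
        using t by (simp add: s_def n_def norm_scaleR power_mult_distrib)
      also have "\<dots> = f y - s\<^sup>2 / (2 * L * n\<^sup>2)"
        using L n by (simp add: t_def field_simps power2_eq_square)
      finally have "s\<^sup>2 \<le> (\<tau> * n)\<^sup>2"
        using L n by (simp add: field_simps power_mult_distrib \<tau>(2))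
      then show ?thesis
        using \<tau>(1) n power2_le_imp_le[of s "\<tau> * n"] by (simp add: s_def n_def)
    qed
  qed
  then show ?thesis
    using power_mono[OF _ dist_dual_cone_nonneg, of "grad y" K \<tau> 2] \<tau>(2) by simp
qed

section \<open>Convergence of the function values\<close>

text \<open>Adding the two strict gradient inequalities between \<open>0\<close> and \<open>z\<close> makes the gradient
  strictly monotone, which a nonpositive Lipschitz constant forbids.\<close>

lemma lipschitz_constant_pos:
  assumes conv: "strictly_convex_grad_on f grad K" and z: "z \<in> K" "z \<noteq> 0"
  shows "0 < L"
proof -
  have K0: "0 \<in> K"
    using K by (rule convex_cone_contains_0)
  have "f z - f 0 > grad 0 \<bullet> (z - 0)" "f 0 - f z > grad z \<bullet> (0 - z)"
    using conv K0 z unfolding strictly_convex_grad_on_def by metis+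
  then have "0 < (grad z - grad 0) \<bullet> z"
    by (simp add: inner_diff_left)
  also have "\<dots> \<le> dual_norm N (grad z - grad 0) * N z"
    by (rule inner_le_dual_norm)
  also have "\<dots> \<le> (L * N (z - 0)) * N z"
    using K0 z by (intro mult_right_mono norm_nonneg dual_norm_grad_diff_le)
  finally have "0 < L * (N z * N z)"
    by (simp add: mult.assoc)
  then show ?thesis
    using norm_nonneg[of z] by (auto simp: zero_less_mult_iff)
qed

context
  fixes g_init :: 'a and x g v :: "nat \<Rightarrow> 'a" and \<eta> \<theta> :: "nat \<Rightarrow> real"
  assumes moco: "moco N K f grad g_init x \<eta> g v \<theta>"
begin

abbreviation (input) y :: "nat \<Rightarrow> 'a" where
  "y k \<equiv> \<eta> k *\<^sub>R x k"

lemma v_mem: "v k \<in> K"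
  and norm_v_le: "N (v k) \<le> 1"
  and v_min: "w \<in> K \<Longrightarrow> N w \<le> 1 \<Longrightarrow> g k \<bullet> v k \<le> g k \<bullet> w"
proof -
  have "is_arg_min (\<lambda>w. g k \<bullet> w) (\<lambda>w. w \<in> K \<and> N w \<le> 1) (v k)"
    using moco unfolding moco_def by blast
  then show "v k \<in> K" "N (v k) \<le> 1"
    "w \<in> K \<Longrightarrow> N w \<le> 1 \<Longrightarrow> g k \<bullet> v k \<le> g k \<bullet> w"
    by (auto simp: is_arg_min_def not_less)
qed

lemma eta_nonneg: "0 \<le> \<eta> k"
  and eta_min: "0 \<le> s \<Longrightarrow> f (y k) \<le> f (s *\<^sub>R x k)"
proof -
  have "is_arg_min (\<lambda>s. f (s *\<^sub>R x k)) (\<lambda>s. 0 \<le> s) (\<eta> k)"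
    using moco unfolding moco_def by blast
  then show "0 \<le> \<eta> k" "0 \<le> s \<Longrightarrow> f (y k) \<le> f (s *\<^sub>R x k)"
    by (auto simp: is_arg_min_def not_less)
qed

lemma x_Suc: "x (Suc k) = y k + \<theta> k *\<^sub>R v k"
  using moco unfolding moco_def by blast

lemma theta_nonneg: "0 \<le> \<theta> k"
  and theta_min: "0 \<le> s \<Longrightarrow> f (x (Suc k)) \<le> f (y k + s *\<^sub>R v k)"
proof -
  have "is_arg_min (\<lambda>t. f (y k + t *\<^sub>R v k)) (\<lambda>t. 0 \<le> t) (\<theta> k)"
    using moco unfolding moco_def by blast
  then show "0 \<le> \<theta> k" "0 \<le> s \<Longrightarrow> f (x (Suc k)) \<le> f (y k + s *\<^sub>R v k)"
    by (auto simp: is_arg_min_def not_less x_Suc)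
qed

lemma g_0: "g 0 = grad (y 0)"
  using moco by (simp add: moco_def moco_step_def)

lemma g_Suc:
  "g (Suc k) = (1 - moco_step (Suc k)) *\<^sub>R g k + moco_step (Suc k) *\<^sub>R grad (y (Suc k))"
  using moco by (simp add: moco_def)

lemma x_mem: "x k \<in> K"
proof (induction k)
  case 0
  then show ?case
    using moco by (simp add: moco_def)
next
  case (Suc k)
  then show ?case
    using K v_mem eta_nonneg theta_nonneg
    by (simp add: x_Suc convex_cone_add convex_cone_scaleR)
qed

lemma y_mem: "y k \<in> K"
  using K x_mem eta_nonneg by (simp add: convex_cone_scaleR)

lemma grad_y_inner_y: "grad (y k) \<bullet> y k = 0"
proof (rule grad_inner_self_eq_0[OF y_mem])
  show "f (y k) \<le> f (s *\<^sub>R y k)" if "0 \<le> s" for s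
    using eta_min[of "s * \<eta> k" k] eta_nonneg[of k] that by simp
qed

text \<open>The averages of \<open>f (y k)\<close> that match the averages \<open>g k\<close> of the gradients.\<close>

primrec avg :: "nat \<Rightarrow> real" where
  "avg 0 = f (y 0)"
| "avg (Suc k) = (1 - moco_step (Suc k)) * avg k + moco_step (Suc k) * f (y (Suc k))"

text \<open>As \<open>grad (y k)\<close> is orthogonal to \<open>y k\<close>, the tangent of \<open>f\<close> at \<open>y k\<close> is
  \<open>f (y k) + grad (y k) \<bullet> z\<close>; so \<open>avg k + g k \<bullet> z\<close> is an average of tangents.\<close>

lemma avg_tangent_le:
  assumes conv: "strictly_convex_grad_on f grad K" and z: "z \<in> K"
  shows "avg k + g k \<bullet> z \<le> f z"
proof -
  have tangent: "f (y j) + grad (y j) \<bullet> z \<le> f z" for j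
  proof (cases "y j = z")
    case True
    then show ?thesis
      using grad_y_inner_y[of j] by simp
  next
    case False
    then have "grad (y j) \<bullet> (z - y j) < f z - f (y j)"
      using conv z y_mem[of j] by (simp add: strictly_convex_grad_on_def)
    then show ?thesis
      unfolding inner_diff_right grad_y_inner_y by simp
  qed
  show ?thesis
  proof (induction k)
    case 0
    then show ?case
      using tangent[of 0] by (simp add: g_0)
  next
    case (Suc k)
    define d where "d = moco_step (Suc k)"
    have "0 \<le> d" "d \<le> 1"
      by (simp_all add: d_def moco_step_def)
    then have "(1 - d) * (avg k + g k \<bullet> z) + d * (f (y (Suc k)) + grad (y (Suc k)) \<bullet> z)
        \<le> (1 - d) * f z + d * f z"
      using Suc tangent[of "Suc k"] by (intro add_mono mult_left_mono) auto
    then show ?case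
      by (simp add: g_Suc d_def[symmetric] inner_simps algebra_simps)
  qed
qed

lemma moco_descent:
  assumes "0 \<le> L" "0 \<le> s"
  shows "f (y (Suc k)) \<le> f (y k) + s * (grad (y k) \<bullet> v k) + L / 2 * s\<^sup>2"
proof -
  have "f (y (Suc k)) \<le> f (x (Suc k))"
    using eta_min[of 1 "Suc k"] by simp
  also have "\<dots> \<le> f (y k + s *\<^sub>R v k)"
    by (rule theta_min) fact
  also have "\<dots> \<le> f (y k) + grad (y k) \<bullet> (s *\<^sub>R v k) + L / 2 * (N (s *\<^sub>R v k))\<^sup>2"
    using K v_mem y_mem assms
    by (intro descent_lemma) (simp_all add: convex_cone_add convex_cone_scaleR)
  also have "(N (s *\<^sub>R v k))\<^sup>2 \<le> s\<^sup>2"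
    using norm_v_le[of k] norm_nonneg[of "v k"] assms
    by (simp add: norm_scaleR power_mult_distrib mult_left_le power_le_one)
  finally show ?thesis
    using assms by (simp add: mult_left_mono)
qed

text \<open>The estimate-sequence argument of the Frank-Wolfe method with momentum, for the
  minimisation of the averaged tangents over the part of \<open>K\<close> in the ball of radius \<open>R\<close>. The
  minimiser there is \<open>R *\<^sub>R v k\<close>, and the induction compares it with its predecessor. A trial step
  \<open>moco_step k * R\<close> along \<open>v k\<close> replaces the convex combination of the Frank-Wolfe step: by
  orthogonality of \<open>grad (y k)\<close> and \<open>y k\<close>, there is nothing to gain from shrinking \<open>y k\<close>.\<close>

lemma moco_estimate_sequence:
  assumes L: "0 \<le> L" and R: "0 \<le> R"
  shows "f (y (Suc k)) \<le> avg k + R * (g k \<bullet> v k) + 2 * L * R\<^sup>2 / (real k + 2)"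
proof (induction k)
  case 0
  have "f (y (Suc 0)) \<le> f (y 0) + R * (g 0 \<bullet> v 0) + L / 2 * R\<^sup>2"
    using moco_descent[OF L R, of 0] by (simp add: g_0)
  also have "L / 2 * R\<^sup>2 \<le> 2 * L * R\<^sup>2 / (real 0 + 2)"
    using L by simp
  finally show ?case
    by simp
next
  case (Suc k)
  define d where "d = moco_step (Suc k)"
  define D where "D = L * R\<^sup>2"
  have d: "d = 2 / (real k + 3)" "0 \<le> d" "d \<le> 1"
    by (simp_all add: d_def moco_step_def)
  have "g k \<bullet> v k \<le> g k \<bullet> v (Suc k)"
    using v_min v_mem norm_v_le by blast
  then have "R * (g k \<bullet> v k) \<le> R * (g k \<bullet> v (Suc k))"
    using R by (rule mult_left_mono)
  then have IH: "f (y (Suc k)) \<le> avg k + R * (g k \<bullet> v (Suc k)) + 2 * D / (real k + 2)"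
    using Suc by (simp add: D_def mult.assoc)
  have "f (y (Suc (Suc k))) \<le> f (y (Suc k)) + (d * R) * (grad (y (Suc k)) \<bullet> v (Suc k))
      + L / 2 * (d * R)\<^sup>2"
    using d R L by (intro moco_descent) simp_all
  also have "\<dots> = (1 - d) * f (y (Suc k)) + d * f (y (Suc k))
      + (d * R) * (grad (y (Suc k)) \<bullet> v (Suc k)) + D / 2 * d\<^sup>2"
    by (simp add: D_def algebra_simps power_mult_distrib)
  also have "(1 - d) * f (y (Suc k))
      \<le> (1 - d) * (avg k + R * (g k \<bullet> v (Suc k)) + 2 * D / (real k + 2))"
    using IH d by (intro mult_left_mono) simp_all
  also have "(1 - d) * (avg k + R * (g k \<bullet> v (Suc k)) + 2 * D / (real k + 2))
      + d * f (y (Suc k)) + (d * R) * (grad (y (Suc k)) \<bullet> v (Suc k)) + D / 2 * d\<^sup>2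
      = avg (Suc k) + R * (g (Suc k) \<bullet> v (Suc k))
        + D * ((1 - d) * (2 / (real k + 2)) + d\<^sup>2 / 2)"
    by (simp add: g_Suc d_def[symmetric] inner_simps algebra_simps)
  also have "D * ((1 - d) * (2 / (real k + 2)) + d\<^sup>2 / 2) \<le> D * (2 / (real (Suc k) + 2))"
  proof (rule mult_left_mono)
    show "(1 - d) * (2 / (real k + 2)) + d\<^sup>2 / 2 \<le> 2 / (real (Suc k) + 2)"
      by (simp add: d(1) divide_simps power2_eq_square) (simp add: algebra_simps)
    show "0 \<le> D"
      using L by (simp add: D_def)
  qed
  finally show ?case
    by (simp add: D_def mult_ac)
qed

text \<open>At a positive index, the preceding direction \<open>v\<close> was chosen in competition with
  \<open>xs /\<^sub>R N xs\<close>; with \<open>R = N xs\<close>, the minimum of the averaged tangents is therefore at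
  most their value at \<open>xs\<close>, and so at most \<open>f xs\<close>. At index \<open>0\<close> there is no earlier step; there the bound
  holds because the ray through \<open>x 0\<close> contains the origin, whose gap is quadratic in \<open>N xs\<close>.\<close>

lemma moco_gap_le:
  assumes conv: "strictly_convex_grad_on f grad K"
    and min: "is_arg_min f (\<lambda>y. y \<in> K) xs" and xs: "xs \<noteq> 0"
  shows "f (y k) - f xs \<le> 2 * L * (N xs)\<^sup>2 / (real k + 1)"
proof -
  have xs_mem: "xs \<in> K" and xs_min: "\<And>z. z \<in> K \<Longrightarrow> f xs \<le> f z"
    using min by (auto simp: is_arg_min_def not_less)
  have L: "0 < L"
    using lipschitz_constant_pos[OF conv xs_mem xs] .
  have R: "0 < N xs"
    using xs norm_nonneg[of xs] norm_eq_0[of xs] by simp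
  show ?thesis
  proof (cases k)
    case 0
    have "grad xs \<bullet> xs = 0"
      using K xs_mem by (intro grad_inner_self_eq_0 xs_min) (simp_all add: convex_cone_scaleR)
    moreover have "f (y 0) \<le> f 0"
      using eta_min[of 0 0] by simp
    ultimately have "f (y 0) - f xs \<le> L / 2 * (N xs)\<^sup>2"
      using descent_lemma[OF xs_mem, of "- xs"] convex_cone_contains_0[OF K]
      by (simp add: norm_uminus)
    also have "\<dots> \<le> 2 * L * (N xs)\<^sup>2"
      using L by simp
    finally show ?thesis
      using 0 by simp
  next
    case (Suc j)
    have "g j \<bullet> v j \<le> g j \<bullet> (inverse (N xs) *\<^sub>R xs)"
      using K xs_mem R by (intro v_min) (simp_all add: convex_cone_scaleR norm_scaleR)
    then have "N xs * (g j \<bullet> v j) \<le> g j \<bullet> xs"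
      using R by (simp add: field_simps)
    then have "f (y (Suc j)) \<le> f xs + 2 * L * (N xs)\<^sup>2 / (real j + 2)"
      using moco_estimate_sequence[of "N xs" j] avg_tangent_le[OF conv xs_mem, of j] L R by simp
    then show ?thesis
      using Suc by (simp add: add.commute)
  qed
qed

end

end

end

section \<open>Rate of the dual infeasibility of the gradient\<close>

theorem theorem2:
  fixes N :: "real ^ 'n \<Rightarrow> real"
    and K :: "(real ^ 'n) set"
    and f :: "real ^ 'n \<Rightarrow> real"
    and grad :: "real ^ 'n \<Rightarrow> real ^ 'n"
    and L :: real
    and xs g_init :: "real ^ 'n"
    and x g v :: "nat \<Rightarrow> real ^ 'n"
    and \<eta> \<theta> :: "nat \<Rightarrow> real"
    and k :: nat
  assumes "is_norm N"
    and "convex_cone K"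
    and "gradient_on f grad K"
    and "strictly_convex_grad_on f grad K"
    and "lipschitz_gradient_on N L grad K"
    and "is_arg_min f (\<lambda>y. y \<in> K) xs"
    and "xs \<noteq> 0"
    and "moco N K f grad g_init x \<eta> g v \<theta>"
  shows "(dist_wrt (dual_norm N) (grad (\<eta> k *\<^sub>R x k)) (dual_cone K))\<^sup>2
           \<le> 4 * L\<^sup>2 * (N xs)\<^sup>2 / (real k + 1)"
proof -
  note smooth = assms(1,2,3,5)
  have xs: "xs \<in> K" "\<And>z. z \<in> K \<Longrightarrow> f xs \<le> f z"
    using assms(6) by (auto simp: is_arg_min_def not_less)
  have L: "0 < L"
    using lipschitz_constant_pos[OF smooth assms(4) xs(1) assms(7)] .
  have "(dist_wrt (dual_norm N) (grad (\<eta> k *\<^sub>R x k)) (dual_cone K))\<^sup>2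
      \<le> 2 * L * (f (\<eta> k *\<^sub>R x k) - f xs)"
    using dist_dual_cone_sq_le_gap[OF smooth L y_mem[OF smooth assms(8)] xs(2)] .
  also have "\<dots> \<le> 2 * L * (2 * L * (N xs)\<^sup>2 / (real k + 1))"
    using L moco_gap_le[OF smooth assms(8,4,6,7)] by (intro mult_left_mono) simp_all
  also have "\<dots> = 4 * L\<^sup>2 * (N xs)\<^sup>2 / (real k + 1)"
    by (simp add: power2_eq_square)
  finally show ?thesis .
qed

end
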